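(* $|I_k(123)|$ enumerates indecomposable subdiagonal sequences (with sum of entries $k$) where non-diagonal elements are in (strictly) decreasing order. Let \[c_{n,m,k} = \begin{cases} 0 & \text{if } n<0 \text{ or } k<0,\\ 1 & \text{if } n=k=0,\\ c_{n-1,m,k-n+1}+\sum_{i=0}^{\min(n-2,m-1)} c_{n-1,i,k-i} & \text{otherwise.}\end{cases}\] Then the total number of permutations with $k$ inversions (including decomposable ones) avoiding $123$ can be calculated as $\sum_{n=0}^{k+1} c_{n,n,k}$. To obtain the number of such permutations that are indecomposable, subtract the $k$-th coefficient (the coefficient of $x^k$) of $\left(\sum_{i\ge 0} x^{i(i+1)/2}\right)^2$.
   Context: A permutation of length $n$ is a word $\pi=\pi_1\cdots\pi_n$ containing each of $1,\dots,n$ exactly once. The sum of permutations $\rho=\rho_1\cdots\rho_n$ and $\tau=\tau_1\cdots\tau_m$ is the permutation $\rho\oplus\tau=\rho_1\cdots\rho_n(n+\tau_1)\cdots(n+\tau_m)$ of length $n+m$. A permutation is decomposable if it equals $\rho\oplus\tau$ for some non-empty permutations $\rho,\tau$; a permutation that is not decomposable is indecomposable. An inversion of $\pi$ is a pair of indices $(i,j)$ with $i<j$ and $\pi_i>\pi_j$. A permutation $\pi$ contains a pattern (permutation) $\tau=\tau_1\cdots\tau_m$ if there are indices $i_1<\dots<i_m$ such that $\pi_{i_1}\cdots\pi_{i_m}$ is order-isomorphic to $\tau_1\cdots\tau_m$; otherwise $\pi$ avoids $\tau$. $I_k(\tau)$ denotes the (finite) set of all indecomposable permutations, of any length, with exactly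 $k$ inversions that avoid $\tau$. A sequence of $n$ non-negative integers is subdiagonal if its first value is $\le n-1$, the next $\le n-2$, and so on, i.e. its $i$-th value is $\le n-i$. Elements of a subdiagonal sequence that are equal to their maximum possible value (the $i$-th value being equal to $n-i$) are called diagonal elements; the others are non-diagonal. The sum of two subdiagonal sequences $\rho_1,\dots,\rho_p$ and $\tau_1,\dots,\tau_\ell$ is the sequence $\rho_1,\dots,\rho_p,\tau_1+p,\dots,\tau_\ell+p$. A subdiagonal sequence is indecomposable if it cannot be written as the sum of two non-empty subdiagonal sequences. A sum whose upper limit is less than its lower limit is empty.
   Formalization: The sum of subdiagonal sequences is taken as plain concatenation, without adding p (with the shift the first claim fails at k=1); the upper limit k+1 is replaced by k+2 for all k, and the printed limit k+1 is asserted only for k≥3 (it fails at k=1,2, and at k=0 when counting the empty permutation). *)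

theory Defs
  imports
    "HOL-Combinatorics.Multiset_Permutations"
    "HOL-Computational_Algebra.Formal_Power_Series"
begin

text \<open>
  Words are lists, with positions counted from 0 and values from 1. The empty word is a
  permutation (of length 0), and it is not decomposable.
\<close>

definition is_perm :: "nat list \<Rightarrow> bool" where
  "is_perm p \<longleftrightarrow> p \<in> permutations_of_set {1..length p}"

definition perm_sum :: "nat list \<Rightarrow> nat list \<Rightarrow> nat list" where
  "perm_sum r t = r @ map (\<lambda>x. length r + x) t"

definition perm_decomposable :: "nat list \<Rightarrow> bool" where
  "perm_decomposable p \<longleftrightarrow>
     (\<exists>r t. is_perm r \<and> is_perm t \<and> r \<noteq> [] \<and> t \<noteq> [] \<and> p = perm_sum r t)"

definition inversions :: "nat list \<Rightarrow> (nat \<times> nat) set" where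
  "inversions p = {(i, j). i < j \<and> j < length p \<and> p ! i > p ! j}"

definition contains_pattern :: "nat list \<Rightarrow> nat list \<Rightarrow> bool" where
  "contains_pattern p t \<longleftrightarrow>
     (\<exists>f :: nat \<Rightarrow> nat. strict_mono_on {..<length t} f \<and> f ` {..<length t} \<subseteq> {..<length p} \<and>
        (\<forall>a<length t. \<forall>b<length t. p ! f a < p ! f b \<longleftrightarrow> t ! a < t ! b))"

definition avoiders :: "nat \<Rightarrow> nat list \<Rightarrow> nat list set" where
  "avoiders k t = {p. is_perm p \<and> card (inversions p) = k \<and> \<not> contains_pattern p t}"

definition indec_avoiders :: "nat \<Rightarrow> nat list \<Rightarrow> nat list set" where
  "indec_avoiders k t = {p \<in> avoiders k t. \<not> perm_decomposable p}"

definition subdiagonal :: "nat list \<Rightarrow> bool" where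
  "subdiagonal s \<longleftrightarrow> (\<forall>i<length s. s ! i \<le> length s - Suc i)"

definition is_diagonal :: "nat list \<Rightarrow> nat \<Rightarrow> bool" where
  "is_diagonal s i \<longleftrightarrow> s ! i = length s - Suc i"

definition nondiagonal_decreasing :: "nat list \<Rightarrow> bool" where
  "nondiagonal_decreasing s \<longleftrightarrow>
     (\<forall>i j. i < j \<and> j < length s \<and> \<not> is_diagonal s i \<and> \<not> is_diagonal s j \<longrightarrow> s ! i > s ! j)"

text \<open>
  The sum of two subdiagonal sequences is their concatenation, with no shift of the second
  summand. It corresponds to the sum of permutations: if every entry of a permutation is
  replaced by the number of smaller entries to its right, a sum of permutations becomes a
  concatenation. Adding the length of the first summand to the entries of the second (as is done
  for permutations) would never give a subdiagonal sequence when both summands are non-empty,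
  since the last entry of a subdiagonal sequence is 0.
\<close>

definition subdiag_sum :: "nat list \<Rightarrow> nat list \<Rightarrow> nat list" where
  "subdiag_sum r t = r @ t"

definition subdiag_decomposable :: "nat list \<Rightarrow> bool" where
  "subdiag_decomposable s \<longleftrightarrow>
     (\<exists>r t. subdiagonal r \<and> subdiagonal t \<and> r \<noteq> [] \<and> t \<noteq> [] \<and> s = subdiag_sum r t)"

definition indec_subdiagonals :: "nat \<Rightarrow> nat list set" where
  "indec_subdiagonals k =
     {s. subdiagonal s \<and> \<not> subdiag_decomposable s \<and> sum_list s = k \<and> nondiagonal_decreasing s}"

function c :: "int \<Rightarrow> int \<Rightarrow> int \<Rightarrow> int" where
  "c n m k =
     (if n < 0 \<or> k < 0 then 0
      else if n = 0 \<and> k = 0 then 1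
      else c (n - 1) m (k - n + 1) + (\<Sum>i = 0..min (n - 2) (m - 1). c (n - 1) i (k - i)))"
  by pat_completeness auto
termination
  by (relation "Wellfounded.measure (\<lambda>(n, m, k). nat (n + 1))") auto

declare c.simps [simp del]

text \<open>
  The infinite sum is taken in the topology of formal power series, where it converges.
\<close>

definition triangular_series :: "int fps" where
  "triangular_series = (\<Sum>i::nat. fps_X ^ (i * (i + 1) div 2))"

end

theory Submission
  imports Defs
begin

text \<open>
  The proof sends a permutation \<open>p\<close> to its Lehmer code, the sequence whose \<open>i\<close>-th entry is the number
  of later entries of \<open>p\<close> that are smaller than \<open>p ! i\<close>. This is a length-preserving bijection from
  permutations onto subdiagonal sequences (\<open>bij_betw_lehmer\<close>). It turns the number of inversions
  into the sum of the entries (\<open>sum_list_lehmer\<close>) and sums of permutations into concatenations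
  (\<open>lehmer_perm_sum\<close>, \<open>perm_decomposable_iff\<close>). An entry of the code is non-diagonal iff some later
  entry of \<open>p\<close> is larger, so the middle of an occurrence of 123, and its first element, are
  non-diagonal; this is why \<open>p\<close> avoids 123 iff the non-diagonal entries of its code are strictly
  decreasing (\<open>avoids_123_iff\<close>).

  Such sequences can be counted by their first entry. A diagonal first entry leaves the bound on
  the remaining non-diagonal entries unchanged, and a non-diagonal first entry \<open>i\<close> becomes the new
  bound. This is the recurrence of \<open>c\<close> (\<open>c_eq_card\<close>). The length is bounded in terms of the sum because
  the \<open>a\<close> non-diagonal entries, being distinct, add up to at least \<open>a choose 2\<close>, and likewise for
  the \<open>b\<close> diagonal ones. This gives \<open>length s \<le> k + 2\<close>, and \<open>length s \<le> k + 1\<close> if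
  \<open>k \<ge> 3\<close> (\<open>decr_subdiagonals_length\<close>).

  If a concatenation \<open>r @ t\<close> of non-empty subdiagonal sequences has decreasing non-diagonal entries,
  then all entries of \<open>r\<close> are non-diagonal in \<open>r @ t\<close>, hence \<open>r\<close> decreases to 0 and \<open>t\<close> has no
  non-diagonal entry. So both parts are staircases \<open>n - 1, \<dots>, 1, 0\<close>, whose sums are triangular
  numbers (\<open>decomposable_decr_subdiagonals\<close>), and the decomposable sequences are counted by the
  square of the generating function of the triangular numbers.
\<close>

section \<open>The Lehmer code\<close>

text \<open>
  The Lehmer code counts, for each entry, the smaller entries to its right. It makes sense for any
  list, which allows inductions over sublists of permutations.
\<close>

primrec lehmer :: "nat list \<Rightarrow> nat list" where
  "lehmer [] = []"
| "lehmer (x # xs) = length (filter (\<lambda>y. y < x) xs) # lehmer xs"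

lemma length_lehmer [simp]: "length (lehmer p) = length p"
  by (induction p) auto

lemma lehmer_eq_Nil_iff [simp]: "lehmer p = [] \<longleftrightarrow> p = []"
  by (cases p) auto

lemma nth_lehmer:
  "i < length p \<Longrightarrow> lehmer p ! i = card {j. i < j \<and> j < length p \<and> p ! j < p ! i}"
proof (induction p arbitrary: i)
  case (Cons x xs)
  show ?case
  proof (cases i)
    case 0
    have "{j. 0 < j \<and> j < length (x # xs) \<and> (x # xs) ! j < x} =
          Suc ` {j. j < length xs \<and> xs ! j < x}"
      by (auto simp: image_iff gr0_conv_Suc)
    then show ?thesis using 0 by (simp add: length_filter_conv_card card_image)
  next
    case (Suc i')
    have "{j. i < j \<and> j < length (x # xs) \<and> (x # xs) ! j < (x # xs) ! i} =
          Suc ` {j. i' < j \<and> j < length xs \<and> xs ! j < xs ! i'}"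
      using Suc by (auto simp: image_iff less_Suc_eq_0_disj Suc_less_eq2)
    then show ?thesis using Suc Cons by (simp add: card_image)
  qed
qed simp

lemma subdiagonal_Nil [simp]: "subdiagonal []"
  by (simp add: subdiagonal_def)

lemma subdiagonal_Cons [simp]:
  "subdiagonal (x # xs) \<longleftrightarrow> x \<le> length xs \<and> subdiagonal xs"
  by (auto simp: subdiagonal_def All_less_Suc2)

lemma subdiagonal_lehmer: "subdiagonal (lehmer p)"
  by (induction p) auto

lemma sum_list_lehmer: "sum_list (lehmer p) = card (inversions p)"
proof (induction p)
  case Nil
  then show ?case by (simp add: inversions_def)
next
  case (Cons x xs)
  let ?A = "(\<lambda>j. (0 :: nat, Suc j)) ` {j. j < length xs \<and> xs ! j < x}"
  let ?B = "map_prod Suc Suc ` inversions xs"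
  have "inversions (x # xs) = ?A \<union> ?B"
  proof (intro set_eqI)
    fix u :: "nat \<times> nat"
    obtain i j where u: "u = (i, j)" by force
    show "u \<in> inversions (x # xs) \<longleftrightarrow> u \<in> ?A \<union> ?B"
      unfolding u by (cases i; cases j) (auto simp: inversions_def image_iff)
  qed
  moreover have "finite (inversions xs)"
    by (rule finite_subset[of _ "{..<length xs} \<times> {..<length xs}"]) (auto simp: inversions_def)
  moreover have "?A \<inter> ?B = {}" by auto
  moreover have "card ?A = length (filter (\<lambda>y. y < x) xs)"
    by (subst card_image) (auto simp: inj_on_def length_filter_conv_card)
  moreover have "card ?B = card (inversions xs)"
    by (rule card_image) (auto simp: inj_on_def)
  ultimately show ?case using Cons by (simp add: card_Un_disjoint)
qed

lemma inj_on_rank: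
  fixes A :: "'a :: linorder set"
  assumes "finite A"
  shows "inj_on (\<lambda>x. card {z \<in> A. z < x}) A"
proof -
  have "card {z \<in> A. z < x} < card {z \<in> A. z < y}" if "x \<in> A" "x < y" for x y
    by (rule psubset_card_mono) (use assms that in auto)
  then show ?thesis by (intro linorder_inj_onI) (force+)
qed

lemma ex_rank:
  fixes A :: "'a :: linorder set"
  assumes "finite A" "n < card A"
  shows "\<exists>x\<in>A. card {z \<in> A. z < x} = n"
proof -
  let ?r = "\<lambda>x. card {z \<in> A. z < x}"
  have "?r x < card A" if "x \<in> A" for x
    by (rule psubset_card_mono) (use assms that in auto)
  then have "?r ` A \<subseteq> {..<card A}" by auto
  then have "?r ` A = {..<card A}"
    using card_image[OF inj_on_rank[OF assms(1)]] by (intro card_subset_eq) auto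
  then show ?thesis using assms(2) by (metis (no_types, lifting) imageE lessThan_iff)
qed

lemma hd_lehmer_rank:
  fixes x :: nat
  assumes "distinct (x # xs)"
  shows "length (filter (\<lambda>y. y < x) xs) = card {z \<in> set (x # xs). z < x}"
proof -
  have "{z \<in> set (x # xs). z < x} = {y. y < x} \<inter> set xs" by auto
  then show ?thesis using assms by (simp add: distinct_length_filter)
qed

text \<open>
  The head of the code is the rank of the head of the list within its set of entries. Therefore the
  code and the set of entries determine the list, entry by entry.
\<close>

lemma lehmer_inj:
  assumes "distinct p" "distinct q" "set p = set q" "lehmer p = lehmer q"
  shows "p = q"
  using assms
proof (induction p arbitrary: q)
  case Nil
  then show ?case by simp
next
  case (Cons x xs)
  from Cons.prems obtain y ys where q: "q = y # ys" by (cases q) auto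
  let ?A = "set (x # xs)"
  have "card {z \<in> ?A. z < x} = card {z \<in> ?A. z < y}"
  proof -
    have "card {z \<in> ?A. z < x} = length (filter (\<lambda>z. z < x) xs)"
      by (rule hd_lehmer_rank[symmetric]) fact
    also have "\<dots> = length (filter (\<lambda>z. z < y) ys)" using Cons.prems(4) q by simp
    also have "\<dots> = card {z \<in> ?A. z < y}"
      using hd_lehmer_rank[of y ys] Cons.prems(2,3) unfolding q by (simp only:)
    finally show ?thesis .
  qed
  then have "x = y"
    using inj_onD[OF inj_on_rank[of ?A], of x y] Cons.prems q by auto
  moreover have "xs = ys"
    by (rule Cons.IH) (use Cons.prems q \<open>x = y\<close> in auto)
  ultimately show ?case using q by simp
qed

lemma lehmer_surj:
  assumes "subdiagonal s" "finite A" "card A = length s"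
  shows "\<exists>p. distinct p \<and> set p = A \<and> lehmer p = s"
  using assms
proof (induction s arbitrary: A)
  case Nil
  then show ?case by simp
next
  case (Cons n s)
  obtain x where x: "x \<in> A" "card {z \<in> A. z < x} = n"
    using ex_rank[of A n] Cons.prems by auto
  obtain p where p: "distinct p" "set p = A - {x}" "lehmer p = s"
    using Cons.IH[of "A - {x}"] Cons.prems x by auto
  have "distinct (x # p)" "set (x # p) = A" using p x by auto
  moreover from this have "lehmer (x # p) = n # s"
    using hd_lehmer_rank[of x p] p(3) x(2) by simp
  ultimately show ?case by blast
qed

section \<open>Permutations and subdiagonal sequences\<close>

lemma is_perm_iff: "is_perm p \<longleftrightarrow> distinct p \<and> set p = {1..length p}"
  by (auto simp: is_perm_def permutations_of_set_def)

lemma bij_betw_lehmer: "bij_betw lehmer (Collect is_perm) (Collect subdiagonal)"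
proof (rule bij_betw_imageI)
  show "inj_on lehmer (Collect is_perm)"
    by (rule inj_onI) (metis is_perm_iff lehmer_inj length_lehmer mem_Collect_eq)
  show "lehmer ` Collect is_perm = Collect subdiagonal"
  proof (intro equalityI subsetI)
    fix s assume "s \<in> Collect subdiagonal"
    then obtain p where "distinct p" "set p = {1..length s}" "lehmer p = s"
      using lehmer_surj[of s "{1..length s}"] by auto
    then have "is_perm p" "lehmer p = s"
      unfolding is_perm_iff by auto
    then show "s \<in> lehmer ` Collect is_perm" by auto
  qed (use subdiagonal_lehmer in auto)
qed

lemma lehmer_append:
  assumes "\<forall>x\<in>set xs. \<forall>y\<in>set ys. x < y"
  shows "lehmer (xs @ ys) = lehmer xs @ lehmer ys"
  using assms
proof (induction xs)
  case (Cons x xs)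
  have "filter (\<lambda>y. y < x) ys = []" using Cons.prems by (force simp: filter_empty_conv)
  then show ?case using Cons by simp
qed simp

lemma lehmer_map_add: "lehmer (map (\<lambda>x. n + x) t) = lehmer t"
  by (induction t) (simp_all add: filter_map o_def)

lemma is_perm_perm_sum:
  assumes "is_perm r" "is_perm t"
  shows "is_perm (perm_sum r t)"
proof -
  have "set (perm_sum r t) = {1..length r} \<union> {length r + 1..length r + length t}"
    using assms by (simp add: perm_sum_def is_perm_iff add.commute)
  also have "\<dots> = {1..length (perm_sum r t)}" by (auto simp: perm_sum_def)
  finally show ?thesis using assms by (auto simp: is_perm_iff perm_sum_def distinct_map)
qed

lemma lehmer_perm_sum:
  assumes "is_perm r" "is_perm t"
  shows "lehmer (perm_sum r t) = lehmer r @ lehmer t"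
proof -
  have "\<forall>x\<in>set r. \<forall>y\<in>set (map (\<lambda>x. length r + x) t). x < y"
    using assms by (auto simp: is_perm_iff)
  then show ?thesis by (simp add: perm_sum_def lehmer_append lehmer_map_add)
qed

lemma perm_decomposable_iff:
  assumes "is_perm p"
  shows "perm_decomposable p \<longleftrightarrow> subdiag_decomposable (lehmer p)"
proof
  assume "perm_decomposable p"
  then obtain r t where rt: "is_perm r" "is_perm t" "r \<noteq> []" "t \<noteq> []" "p = perm_sum r t"
    by (auto simp: perm_decomposable_def)
  then have "lehmer p = subdiag_sum (lehmer r) (lehmer t)" "lehmer r \<noteq> []" "lehmer t \<noteq> []"
    by (simp_all add: lehmer_perm_sum subdiag_sum_def)
  then show "subdiag_decomposable (lehmer p)"
    using subdiagonal_lehmer unfolding subdiag_decomposable_def by blast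
next
  assume "subdiag_decomposable (lehmer p)"
  then obtain u v where uv: "subdiagonal u" "subdiagonal v" "u \<noteq> []" "v \<noteq> []"
      "lehmer p = u @ v"
    by (auto simp: subdiag_decomposable_def subdiag_sum_def)
  from uv(1,2) obtain r t where rt: "is_perm r" "lehmer r = u" "is_perm t" "lehmer t = v"
    using bij_betw_imp_surj_on[OF bij_betw_lehmer] by (metis (no_types) imageE mem_Collect_eq)
  then have "lehmer (perm_sum r t) = lehmer p" by (simp add: lehmer_perm_sum uv)
  then have "perm_sum r t = p"
    using inj_onD[OF bij_betw_imp_inj_on[OF bij_betw_lehmer]] is_perm_perm_sum rt assms by auto
  moreover have "r \<noteq> []" "t \<noteq> []" using rt uv by auto
  ultimately show "perm_decomposable p" using rt unfolding perm_decomposable_def by blast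
qed

lemma contains_123_iff:
  "contains_pattern p [1, 2, 3] \<longleftrightarrow>
     (\<exists>i j l. i < j \<and> j < l \<and> l < length p \<and> p ! i < p ! j \<and> p ! j < p ! l)"
proof
  assume "contains_pattern p [1, 2, 3]"
  then obtain f :: "nat \<Rightarrow> nat" where f: "strict_mono_on {..<3} f" "f ` {..<3} \<subseteq> {..<length p}"
    "\<And>a b. a < 3 \<Longrightarrow> b < 3 \<Longrightarrow> p ! f a < p ! f b \<longleftrightarrow> [1, 2, 3 :: nat] ! a < [1, 2, 3] ! b"
    unfolding contains_pattern_def by (auto simp: eval_nat_numeral)
  have "f 0 < f 1" "f 1 < f 2" using f(1) by (auto simp: strict_mono_on_def)
  moreover have "f 2 < length p" using f(2) by (simp add: image_subset_iff)
  moreover have "p ! f 0 < p ! f 1" "p ! f 1 < p ! f 2" using f(3)[of 0 1] f(3)[of 1 2] by auto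
  ultimately show "\<exists>i j l. i < j \<and> j < l \<and> l < length p \<and> p ! i < p ! j \<and> p ! j < p ! l"
    by blast
next
  assume "\<exists>i j l. i < j \<and> j < l \<and> l < length p \<and> p ! i < p ! j \<and> p ! j < p ! l"
  then obtain i j l where *: "i < j" "j < l" "l < length p" "p ! i < p ! j" "p ! j < p ! l"
    by blast
  let ?f = "\<lambda>a :: nat. [i, j, l] ! a"
  have len: "a < length [1, 2, 3 :: nat] \<longleftrightarrow> a = 0 \<or> a = 1 \<or> a = 2" for a :: nat by auto
  have "strict_mono_on {..<length [1, 2, 3 :: nat]} ?f"
    unfolding strict_mono_on_def lessThan_iff len using *(1,2) by auto
  moreover have "?f ` {..<length [1, 2, 3 :: nat]} \<subseteq> {..<length p}"
    unfolding image_subset_iff Ball_def lessThan_iff len using *(1-3) by auto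
  moreover have "\<forall>a<length [1, 2, 3 :: nat]. \<forall>b<length [1, 2, 3 :: nat].
      p ! ?f a < p ! ?f b \<longleftrightarrow> [1, 2, 3 :: nat] ! a < [1, 2, 3] ! b"
    unfolding len using *(4,5) by auto
  ultimately show "contains_pattern p [1, 2, 3]"
    unfolding contains_pattern_def by blast
qed

lemma is_diagonal_lehmer_iff:
  assumes "i < length p"
  shows "is_diagonal (lehmer p) i \<longleftrightarrow> (\<forall>l. i < l \<and> l < length p \<longrightarrow> p ! l < p ! i)"
proof -
  let ?S = "{j. i < j \<and> j < length p \<and> p ! j < p ! i}"
  have sub: "?S \<subseteq> {i<..<length p}" by auto
  have "is_diagonal (lehmer p) i \<longleftrightarrow> card ?S = card {i<..<length p}"
    using assms by (simp add: is_diagonal_def nth_lehmer)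
  also have "\<dots> \<longleftrightarrow> ?S = {i<..<length p}"
    using sub by (metis (no_types, lifting) card_subset_eq finite_greaterThanLessThan)
  also have "\<dots> \<longleftrightarrow> (\<forall>l. i < l \<and> l < length p \<longrightarrow> p ! l < p ! i)"
    unfolding set_eq_iff mem_Collect_eq greaterThanLessThan_iff by blast
  finally show ?thesis .
qed

text \<open>
  For \<open>i < j\<close>, if \<open>p ! j < p ! i\<close>, then \<open>lehmer p ! j < lehmer p ! i\<close>. If \<open>p ! i < p ! j\<close>, the codes can
  compare either way, but \<open>lehmer p ! i \<le> lehmer p ! j\<close> holds if \<open>i\<close> is the last position before \<open>j\<close>
  with a value below \<open>p ! j\<close>. Such an \<open>i\<close> can replace the first position of an occurrence of 123.
\<close>

lemma avoids_123_iff: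
  assumes "distinct p"
  shows "contains_pattern p [1, 2, 3] \<longleftrightarrow> \<not> nondiagonal_decreasing (lehmer p)"
proof
  assume "\<not> nondiagonal_decreasing (lehmer p)"
  then obtain i j where ij: "i < j" "j < length p" "\<not> is_diagonal (lehmer p) j"
    "lehmer p ! i \<le> lehmer p ! j"
    unfolding nondiagonal_decreasing_def by (auto simp: not_less)
  obtain l where l: "j < l" "l < length p" "p ! l \<ge> p ! j"
    using ij is_diagonal_lehmer_iff[of j p] by (auto simp: not_less)
  then have l': "p ! j < p ! l"
    using nth_eq_iff_index_eq[OF assms, of j l] by (auto simp: le_less)
  have "p ! i < p ! j"
  proof (rule ccontr)
    assume "\<not> p ! i < p ! j"
    then have gt: "p ! j < p ! i"
      using nth_eq_iff_index_eq[OF assms, of i j] ij by auto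
    have "{m. j < m \<and> m < length p \<and> p ! m < p ! j} \<subset> {m. i < m \<and> m < length p \<and> p ! m < p ! i}"
      using ij gt by auto
    then have "lehmer p ! j < lehmer p ! i"
      using ij by (simp add: nth_lehmer psubset_card_mono)
    then show False using ij by simp
  qed
  then show "contains_pattern p [1, 2, 3]"
    unfolding contains_123_iff using ij l l' by blast
next
  assume "contains_pattern p [1, 2, 3]"
  then obtain i0 j l where *: "i0 < j" "j < l" "l < length p" "p ! i0 < p ! j" "p ! j < p ! l"
    unfolding contains_123_iff by blast
  \<comment> \<open>With this choice no entry between \<open>i\<close> and \<open>j\<close> is smaller than \<open>p ! i\<close>.\<close>
  define i where "i = Max {i. i < j \<and> p ! i < p ! j}"
  have "i \<in> {i. i < j \<and> p ! i < p ! j}"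
    unfolding i_def by (rule Max_in) (use * in auto)
  then have i: "i < j" "p ! i < p ! j" by auto
  have max: "m \<le> i" if "m < j" "p ! m < p ! j" for m
    unfolding i_def by (rule Max_ge) (use that in auto)
  have "{m. i < m \<and> m < length p \<and> p ! m < p ! i} \<subseteq> {m. j < m \<and> m < length p \<and> p ! m < p ! j}"
  proof safe
    fix m assume m: "i < m" "m < length p" "p ! m < p ! i"
    then show "j < m" using max[of m] i by (cases m j rule: linorder_cases) auto
    show "p ! m < p ! j" using m i by simp
  qed
  then have "lehmer p ! i \<le> lehmer p ! j"
    using i * by (simp add: nth_lehmer card_mono)
  moreover have "\<not> is_diagonal (lehmer p) i"
    using is_diagonal_lehmer_iff[of i p] i * by (metis less_trans not_less_iff_gr_or_eq)
  moreover have "\<not> is_diagonal (lehmer p) j"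
    using is_diagonal_lehmer_iff[of j p] * by (metis less_trans not_less_iff_gr_or_eq)
  ultimately show "\<not> nondiagonal_decreasing (lehmer p)"
    unfolding nondiagonal_decreasing_def using i(1) *(2,3)
    by (intro notI) (drule spec[of _ i], drule spec[of _ j], simp)
qed

text \<open>
  The subdiagonal sequences with sum \<open>k\<close> whose non-diagonal entries are strictly decreasing,
  decomposable or not.
\<close>

definition decr_subdiagonals :: "nat \<Rightarrow> nat list set" where
  "decr_subdiagonals k = {s. subdiagonal s \<and> nondiagonal_decreasing s \<and> sum_list s = k}"

lemma bij_betw_avoiders: "bij_betw lehmer (avoiders k [1, 2, 3]) (decr_subdiagonals k)"
proof -
  have iff: "p \<in> avoiders k [1, 2, 3] \<longleftrightarrow> is_perm p \<and> lehmer p \<in> decr_subdiagonals k" for p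
    using avoids_123_iff[of p] subdiagonal_lehmer[of p]
    by (auto simp: avoiders_def decr_subdiagonals_def sum_list_lehmer is_perm_iff)
  have "lehmer ` avoiders k [1, 2, 3] = decr_subdiagonals k"
  proof (intro equalityI subsetI)
    fix s assume s: "s \<in> decr_subdiagonals k"
    then obtain p where "is_perm p" "s = lehmer p"
      using bij_betw_imp_surj_on[OF bij_betw_lehmer] by (auto simp: decr_subdiagonals_def)
    then show "s \<in> lehmer ` avoiders k [1, 2, 3]" using s iff by blast
  qed (use iff in blast)
  then show ?thesis
    using bij_betw_subset[OF bij_betw_lehmer, of "avoiders k [1, 2, 3]"] iff by blast
qed

lemma bij_betw_indec_avoiders:
  "bij_betw lehmer (indec_avoiders k [1, 2, 3]) (indec_subdiagonals k)"
proof (rule bij_betw_subset[OF bij_betw_avoiders])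
  show "indec_avoiders k [1, 2, 3] \<subseteq> avoiders k [1, 2, 3]" by (auto simp: indec_avoiders_def)
  have "indec_avoiders k [1, 2, 3] =
      {p \<in> avoiders k [1, 2, 3]. \<not> subdiag_decomposable (lehmer p)}"
    using perm_decomposable_iff by (auto simp: indec_avoiders_def avoiders_def)
  moreover have "indec_subdiagonals k =
      {s \<in> lehmer ` avoiders k [1, 2, 3]. \<not> subdiag_decomposable s}"
    unfolding bij_betw_imp_surj_on[OF bij_betw_avoiders]
    by (auto simp: indec_subdiagonals_def decr_subdiagonals_def)
  ultimately show "lehmer ` indec_avoiders k [1, 2, 3] = indec_subdiagonals k" by auto
qed

section \<open>Counting by the recurrence\<close>

text \<open>
  A subdiagonal sequence whose non-diagonal entries are strictly decreasing and all smaller than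
  \<open>m\<close>, described through its first entry; \<open>nondiag_below_iff\<close> shows that this is the meaning.
\<close>

primrec nondiag_below :: "nat \<Rightarrow> nat list \<Rightarrow> bool" where
  "nondiag_below m [] \<longleftrightarrow> True"
| "nondiag_below m (x # xs) \<longleftrightarrow>
     x = length xs \<and> nondiag_below m xs \<or> x < length xs \<and> x < m \<and> nondiag_below x xs"

lemma is_diagonal_Cons_0: "is_diagonal (x # xs) 0 \<longleftrightarrow> x = length xs"
  by (simp add: is_diagonal_def)

lemma is_diagonal_Cons_Suc: "is_diagonal (x # xs) (Suc i) \<longleftrightarrow> is_diagonal xs i"
  by (simp add: is_diagonal_def)

lemma nondiagonal_decreasing_Cons:
  "nondiagonal_decreasing (x # xs) \<longleftrightarrow> nondiagonal_decreasing xs \<and>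
     (x \<noteq> length xs \<longrightarrow> (\<forall>j<length xs. \<not> is_diagonal xs j \<longrightarrow> xs ! j < x))"
  (is "?L \<longleftrightarrow> ?R")
proof
  assume L: ?L
  show ?R
  proof (intro conjI impI allI)
    show "nondiagonal_decreasing xs"
      unfolding nondiagonal_decreasing_def
    proof (intro allI impI)
      fix i j assume "i < j \<and> j < length xs \<and> \<not> is_diagonal xs i \<and> \<not> is_diagonal xs j"
      then show "xs ! j < xs ! i"
        using L[unfolded nondiagonal_decreasing_def, rule_format, of "Suc i" "Suc j"]
        by (simp add: is_diagonal_Cons_Suc)
    qed
  next
    fix j assume "x \<noteq> length xs" "j < length xs" "\<not> is_diagonal xs j"
    then show "xs ! j < x"
      using L[unfolded nondiagonal_decreasing_def, rule_format, of 0 "Suc j"]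
      by (simp add: is_diagonal_Cons_Suc is_diagonal_Cons_0)
  qed
next
  assume R: ?R
  show ?L
    unfolding nondiagonal_decreasing_def
  proof (intro allI impI)
    fix i j
    assume "i < j \<and> j < length (x # xs) \<and> \<not> is_diagonal (x # xs) i \<and> \<not> is_diagonal (x # xs) j"
    then show "(x # xs) ! j < (x # xs) ! i"
      using R by (cases i; cases j)
        (auto simp: is_diagonal_Cons_Suc is_diagonal_Cons_0 nondiagonal_decreasing_def)
  qed
qed

lemma nondiag_below_iff:
  "nondiag_below m s \<longleftrightarrow> subdiagonal s \<and> nondiagonal_decreasing s \<and>
     (\<forall>i<length s. \<not> is_diagonal s i \<longrightarrow> s ! i < m)"
proof (induction s arbitrary: m)
  case Nil
  then show ?case by (simp add: nondiagonal_decreasing_def)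
next
  case (Cons x xs)
  show ?case
    unfolding nondiag_below.simps Cons.IH nondiagonal_decreasing_Cons subdiagonal_Cons
    by (auto simp: All_less_Suc2 is_diagonal_Cons_Suc is_diagonal_Cons_0)
qed

lemma nondiag_below_length_iff:
  "nondiag_below (length s) s \<longleftrightarrow> subdiagonal s \<and> nondiagonal_decreasing s"
proof -
  have "s ! i < length s" if "subdiagonal s" "i < length s" for i
    using that by (force simp: subdiagonal_def)
  then show ?thesis by (auto simp: nondiag_below_iff)
qed

text \<open>
  The sequences counted by \<open>c n m k\<close>. The sum \<open>k\<close> is an integer, so that the recurrence below needs
  no case distinction: the set is empty for negative \<open>k\<close>.
\<close>

definition nondiag_below_seqs :: "nat \<Rightarrow> nat \<Rightarrow> int \<Rightarrow> nat list set" where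
  "nondiag_below_seqs n m k = {s. length s = n \<and> nondiag_below m s \<and> int (sum_list s) = k}"

lemma finite_nondiag_below_seqs: "finite (nondiag_below_seqs n m k)"
proof (rule finite_subset)
  show "nondiag_below_seqs n m k \<subseteq> {s. set s \<subseteq> {..nat k} \<and> length s = n}"
    using member_le_sum_list by (fastforce simp: nondiag_below_seqs_def)
qed (simp add: finite_lists_length_eq)

lemma nondiag_below_seqs_Suc:
  "nondiag_below_seqs (Suc n) m k = (#) n ` nondiag_below_seqs n m (k - int n) \<union>
     (\<Union>i<min n m. (#) i ` nondiag_below_seqs n i (k - int i))"
proof (intro set_eqI iffI)
  fix s assume "s \<in> nondiag_below_seqs (Suc n) m k"
  then show "s \<in> (#) n ` nondiag_below_seqs n m (k - int n) \<union>
     (\<Union>i<min n m. (#) i ` nondiag_below_seqs n i (k - int i))"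
    by (cases s) (auto simp: nondiag_below_seqs_def image_iff)
qed (auto simp: nondiag_below_seqs_def)

lemma card_nondiag_below_seqs_Suc:
  "card (nondiag_below_seqs (Suc n) m k) =
     card (nondiag_below_seqs n m (k - int n)) +
     (\<Sum>i<min n m. card (nondiag_below_seqs n i (k - int i)))"
proof -
  have "card (\<Union>i<min n m. (#) i ` nondiag_below_seqs n i (k - int i)) =
      (\<Sum>i<min n m. card ((#) i ` nondiag_below_seqs n i (k - int i)))"
    by (rule card_UN_disjoint) (auto simp: finite_nondiag_below_seqs)
  moreover have "(#) n ` nondiag_below_seqs n m (k - int n) \<inter>
      (\<Union>i<min n m. (#) i ` nondiag_below_seqs n i (k - int i)) = {}"
    by auto
  ultimately show ?thesis
    unfolding nondiag_below_seqs_Suc by (simp add: card_Un_disjoint finite_nondiag_below_seqs card_image)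
qed

lemma c_eq_card: "c (int n) (int m) k = int (card (nondiag_below_seqs n m k))"
proof (induction n arbitrary: m k)
  case 0
  have "nondiag_below_seqs 0 m k = (if k = 0 then {[]} else {})" by (auto simp: nondiag_below_seqs_def)
  moreover have "c (- 1) (int m) (k + 1) = 0" by (simp add: c.simps)
  ultimately show ?case by (auto simp: c.simps[of 0])
next
  case (Suc n)
  show ?case
  proof (cases "k < 0")
    case True
    then have "nondiag_below_seqs (Suc n) m k = {}" by (auto simp: nondiag_below_seqs_def)
    then show ?thesis using True by (simp add: c.simps)
  next
    case False
    have "{0..min (int n - 1) (int m - 1)} = int ` {..<min n m}"
      unfolding lessThan_atLeast0 image_int_atLeastLessThan by auto
    then have "(\<Sum>i = 0..min (int n - 1) (int m - 1). c (int n) i (k - i)) =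
        (\<Sum>i<min n m. c (int n) (int i) (k - int i))"
      by (simp add: sum.reindex)
    then show ?thesis
      using False by (subst c.simps) (simp add: card_nondiag_below_seqs_Suc Suc.IH)
  qed
qed

section \<open>The length of a sequence with given sum\<close>

text \<open>
  Here \<open>a\<close> is the number of non-diagonal and \<open>b\<close> the number of diagonal entries. In the induction
  step a diagonal entry \<open>x\<close> satisfies \<open>b \<le> x\<close>, because \<open>x\<close> is the length of the tail, and a
  non-diagonal one satisfies \<open>a \<le> x\<close>, because the \<open>a\<close> non-diagonal entries of the tail are below \<open>x\<close>.
\<close>

lemma sum_list_lower_bound:
  "nondiag_below m s \<Longrightarrow> \<exists>a b. a + b = length s \<and> a \<le> m \<and>
     a * (a - 1) + b * (b - 1) \<le> 2 * sum_list s"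
proof (induction s arbitrary: m)
  case Nil
  then show ?case by simp
next
  case (Cons x xs)
  from Cons.prems consider "x = length xs" "nondiag_below m xs" | "x < m" "nondiag_below x xs" by auto
  then show ?case
  proof cases
    case 1
    from Cons.IH[OF 1(2)] obtain a b where ab: "a + b = length xs" "a \<le> m"
      "a * (a - 1) + b * (b - 1) \<le> 2 * sum_list xs" by blast
    have "Suc b * b = b * (b - 1) + 2 * b" by (cases b) auto
    then show ?thesis using ab 1(1) by (intro exI[of _ a] exI[of _ "Suc b"]) auto
  next
    case 2
    from Cons.IH[OF 2(2)] obtain a b where ab: "a + b = length xs" "a \<le> x"
      "a * (a - 1) + b * (b - 1) \<le> 2 * sum_list xs" by blast
    have "Suc a * a = a * (a - 1) + 2 * a" by (cases a) auto
    then show ?thesis using ab 2(1) by (intro exI[of _ "Suc a"] exI[of _ b]) auto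
  qed
qed

lemma decr_subdiagonals_length:
  assumes "s \<in> decr_subdiagonals k"
  shows "length s \<le> k + 2" "k \<ge> 3 \<Longrightarrow> length s \<le> k + 1"
proof -
  have "nondiag_below (length s) s" "sum_list s = k"
    using assms by (auto simp: decr_subdiagonals_def nondiag_below_length_iff)
  then obtain a b where ab: "a + b = length s" "a * (a - 1) + b * (b - 1) \<le> 2 * k"
    using sum_list_lower_bound by metis
  have lin3: "2 * a \<le> a * (a - 1)" if "a \<ge> 3" for a :: nat
    by (subst mult.commute[of a], rule mult_le_mono1) (use that in simp)
  have lin: "2 * a \<le> a * (a - 1) + 2" for a :: nat
  proof (cases "a \<le> 2")
    case True
    then have "a = 0 \<or> a = 1 \<or> a = 2" by auto
    then show ?thesis by auto
  next
    case False
    then show ?thesis using lin3[of a] by linarith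
  qed
  show "length s \<le> k + 2" using lin[of a] lin[of b] ab by linarith
  \<comment> \<open>A sequence of length at least 5 has 3 entries of one kind, and then \<open>lin3\<close> gains 2 over \<open>lin\<close>.\<close>
  show "length s \<le> k + 1" if "k \<ge> 3"
  proof (rule ccontr)
    assume "\<not> length s \<le> k + 1"
    then have "a \<ge> 3 \<or> b \<ge> 3" using ab that by linarith
    then show False
      using lin[of a] lin[of b] lin3[of a] lin3[of b] ab \<open>\<not> length s \<le> k + 1\<close> by linarith
  qed
qed

lemma card_decr_subdiagonals:
  assumes "\<And>s. s \<in> decr_subdiagonals k \<Longrightarrow> length s \<le> N"
  shows "finite (decr_subdiagonals k)"
    "int (card (decr_subdiagonals k)) = (\<Sum>n = 0..N. c (int n) (int n) (int k))"
proof -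
  have eq: "decr_subdiagonals k = (\<Union>n\<in>{0..N}. nondiag_below_seqs n n (int k))"
    using assms by (auto simp: decr_subdiagonals_def nondiag_below_seqs_def nondiag_below_length_iff)
  show "finite (decr_subdiagonals k)" unfolding eq by (auto simp: finite_nondiag_below_seqs)
  have "card (decr_subdiagonals k) = (\<Sum>n = 0..N. card (nondiag_below_seqs n n (int k)))"
    unfolding eq
    by (rule card_UN_disjoint) (auto simp: finite_nondiag_below_seqs, auto simp: nondiag_below_seqs_def)
  then show "int (card (decr_subdiagonals k)) = (\<Sum>n = 0..N. c (int n) (int n) (int k))"
    by (simp add: c_eq_card)
qed

section \<open>Decomposable sequences and triangular numbers\<close>

text \<open>The triangular numbers, starting with 0.\<close>

definition tri :: "nat \<Rightarrow> nat" where
  "tri i = i * (i + 1) div 2"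

lemma tri_0 [simp]: "tri 0 = 0"
  by (simp add: tri_def)

lemma tri_Suc: "tri (Suc i) = Suc i + tri i"
proof -
  have "Suc i * (Suc i + 1) = i * (i + 1) + Suc i * 2" by simp
  then show ?thesis unfolding tri_def by simp
qed

lemma strict_mono_tri: "strict_mono tri"
  unfolding strict_mono_Suc_iff by (simp add: tri_Suc)

lemma inj_tri: "inj tri"
  using strict_mono_tri by (rule strict_mono_imp_inj_on)

lemma le_tri: "i \<le> tri i"
  using strict_mono_tri by (rule strict_mono_imp_increasing)

text \<open>
  The sequence \<open>n - 1, \<dots>, 1, 0\<close>. It is the code of the decreasing permutation of length \<open>n\<close>.
\<close>

definition staircase :: "nat \<Rightarrow> nat list" where
  "staircase n = rev [0..<n]"

lemma staircase_simps [simp]: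
  "staircase 0 = []" "staircase (Suc n) = n # staircase n" "length (staircase n) = n"
  by (simp_all add: staircase_def)

lemma sum_list_staircase: "sum_list (staircase (Suc n)) = tri n"
proof (induction n)
  case (Suc n)
  then show ?case unfolding tri_Suc by simp
qed simp

lemma subdiagonal_staircase: "subdiagonal (staircase n)"
  by (induction n) auto

lemma nondiag_below_staircases: "a \<le> m \<Longrightarrow> nondiag_below m (staircase a @ staircase b)"
proof (induction a arbitrary: m)
  case 0
  show ?case by (induction b) auto
qed auto

text \<open>
  The entries of \<open>r\<close> are non-diagonal in \<open>r @ t\<close>, so they decrease strictly and the \<open>i\<close>-th of them is at
  least \<open>length r - Suc i\<close>; as \<open>r\<close> is subdiagonal, equality holds. The last entry of \<open>r\<close> is then 0,
  which is the bound left for the non-diagonal entries of \<open>t\<close>.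
\<close>

lemma nondiag_below_appendD:
  assumes "nondiag_below m (r @ t)" "subdiagonal r" "t \<noteq> []"
  shows "length r \<le> m \<and> r = staircase (length r) \<and> nondiag_below (if r = [] then m else 0) t"
  using assms
proof (induction r arbitrary: m)
  case Nil
  then show ?case by simp
next
  case (Cons x xs)
  have "x \<noteq> length (xs @ t)" using Cons.prems by auto
  then have x: "x < m" "nondiag_below x (xs @ t)" "x \<le> length xs" using Cons.prems by auto
  from Cons.IH[OF x(2)] Cons.prems
  have IH: "length xs \<le> x" "xs = staircase (length xs)" "nondiag_below (if xs = [] then x else 0) t"
    by auto
  then have "x = length xs" using x by simp
  then show ?case using IH x by (cases "xs = []") auto
qed

lemma nondiag_below_0: "nondiag_below 0 t \<Longrightarrow> t = staircase (length t)"
  by (induction t) auto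

lemma decomposable_decr_subdiagonals:
  "{s \<in> decr_subdiagonals k. subdiag_decomposable s} =
     (\<lambda>(a, b). staircase (Suc a) @ staircase (Suc b)) ` {(a, b). tri a + tri b = k}"
  (is "?L = ?R")
proof (intro equalityI subsetI)
  fix s assume s: "s \<in> ?L"
  then obtain r t where rt: "subdiagonal r" "r \<noteq> []" "t \<noteq> []" "s = r @ t"
    by (auto simp: subdiag_decomposable_def subdiag_sum_def)
  have "nondiag_below (length s) s"
    using s by (auto simp: decr_subdiagonals_def nondiag_below_length_iff)
  then have "nondiag_below (length s) (r @ t)" unfolding rt(4) .
  from nondiag_below_appendD[OF this] rt
  have "r = staircase (length r)" "t = staircase (length t)" using nondiag_below_0 by auto
  moreover obtain a b where "length r = Suc a" "length t = Suc b"
    using rt by (metis length_0_conv not0_implies_Suc)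
  ultimately have *: "s = staircase (Suc a) @ staircase (Suc b)" using rt(4) by metis
  then have "tri a + tri b = k"
    using s unfolding decr_subdiagonals_def mem_Collect_eq by (metis sum_list_append sum_list_staircase)
  then show "s \<in> ?R" using * by (intro image_eqI[of _ _ "(a, b)"]) auto
next
  fix s assume "s \<in> ?R"
  then obtain a b where s: "s = staircase (Suc a) @ staircase (Suc b)" "tri a + tri b = k"
    by auto
  have "sum_list s = k" using s by (simp only: sum_list_append sum_list_staircase)
  moreover have "nondiag_below (length s) s"
    unfolding s(1) by (rule nondiag_below_staircases) simp
  moreover have "subdiag_decomposable s"
    unfolding subdiag_decomposable_def subdiag_sum_def
    by (rule exI[of _ "staircase (Suc a)"], rule exI[of _ "staircase (Suc b)"])
      (simp add: s(1) subdiagonal_staircase)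
  ultimately show "s \<in> ?L"
    unfolding decr_subdiagonals_def mem_Collect_eq nondiag_below_length_iff by blast
qed

lemma card_decomposable_decr_subdiagonals:
  "card {s \<in> decr_subdiagonals k. subdiag_decomposable s} = card {(a, b). tri a + tri b = k}"
  unfolding decomposable_decr_subdiagonals
proof (rule card_image, rule inj_onI, clarify)
  fix a b a' b' :: nat
  assume eq: "staircase (Suc a) @ staircase (Suc b) = staircase (Suc a') @ staircase (Suc b')"
  from arg_cong[OF eq, of length] arg_cong[OF eq, of hd] show "a = a' \<and> b = b'" by simp
qed

lemma triangular_series_nth: "fps_nth triangular_series n = (if n \<in> range tri then 1 else 0)"
proof -
  define F :: "int fps" where "F = Abs_fps (\<lambda>n. if n \<in> range tri then 1 else 0)"
  have "(\<lambda>i. fps_X ^ tri i :: int fps) sums F"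
    unfolding sums_def
  proof (rule tendsto_fpsI)
    fix n
    \<comment> \<open>As \<open>i \<le> tri i\<close>, the summands from index \<open>n + 1\<close> on do not affect the \<open>n\<close>-th coefficient.\<close>
    have "fps_nth (\<Sum>i<N. fps_X ^ tri i :: int fps) n = fps_nth F n" if "N > n" for N
    proof -
      have "fps_nth (\<Sum>i<N. fps_X ^ tri i :: int fps) n = (\<Sum>i<N. if n = tri i then 1 else 0)"
        by (simp add: fps_sum_nth fps_X_power_iff)
      also have "\<dots> = fps_nth F n"
      proof (cases "n \<in> range tri")
        case True
        then obtain i where i: "n = tri i" by auto
        then have "i < N" using le_tri[of i] that by simp
        have "n = tri j \<longleftrightarrow> j = i" for j using injD[OF inj_tri, of i j] i by auto
        then show ?thesis using True \<open>i < N\<close> by (simp add: F_def)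
      next
        case False
        then have "n \<noteq> tri j" for j by auto
        then show ?thesis using False by (simp add: F_def)
      qed
      finally show ?thesis .
    qed
    then show "\<forall>\<^sub>F N in sequentially. fps_nth (\<Sum>i<N. fps_X ^ tri i) n = fps_nth F n"
      by (meson eventually_sequentiallyI less_eq_Suc_le)
  qed
  then have eq: "triangular_series = F"
    unfolding triangular_series_def tri_def by (rule sums_unique[symmetric])
  show ?thesis unfolding eq by (simp add: F_def)
qed

lemma triangular_series_square_nth:
  "fps_nth (triangular_series ^ 2) k = int (card {(a, b). tri a + tri b = k})"
proof -
  let ?I = "{i \<in> {0..k}. i \<in> range tri \<and> k - i \<in> range tri}"
  have "fps_nth (triangular_series ^ 2) k =
      (\<Sum>i = 0..k. if i \<in> range tri \<and> k - i \<in> range tri then 1 else 0)"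
    unfolding power2_eq_square fps_mult_nth triangular_series_nth
    by (rule sum.cong) auto
  also have "\<dots> = int (card ?I)" by (simp add: sum.If_cases Int_def)
  also have "?I = (\<lambda>(a, b). tri a) ` {(a, b). tri a + tri b = k}"
  proof (intro equalityI subsetI)
    fix i assume "i \<in> ?I"
    then obtain a b where "i = tri a" "k - i = tri b" "i \<le> k" by auto
    then have "(a, b) \<in> {(a, b). tri a + tri b = k}" by simp
    then show "i \<in> (\<lambda>(a, b). tri a) ` {(a, b). tri a + tri b = k}"
      using \<open>i = tri a\<close> by (auto intro!: image_eqI)
  qed auto
  also have "card \<dots> = card {(a, b). tri a + tri b = k}"
  proof (rule card_image, rule inj_onI, unfold mem_Collect_eq split_paired_all prod.case)
    fix a b a' b' assume "tri a + tri b = k" "tri a' + tri b' = k" "tri a = tri a'"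
    then have "tri a = tri a'" "tri b = tri b'" by simp_all
    then show "(a, b) = (a', b')" using inj_tri by (simp add: inj_eq)
  qed
  finally show ?thesis .
qed

section \<open>The enumeration\<close>

theorem theorem9:
  fixes k :: nat
  shows
    "finite (indec_avoiders k [1, 2, 3]) \<and> finite (indec_subdiagonals k) \<and>
     card (indec_avoiders k [1, 2, 3]) = card (indec_subdiagonals k) \<and>
     finite (avoiders k [1, 2, 3]) \<and>
     int (card (avoiders k [1, 2, 3])) = (\<Sum>n = 0..k + 2. c (int n) (int n) (int k)) \<and>
     int (card (indec_avoiders k [1, 2, 3])) =
       (\<Sum>n = 0..k + 2. c (int n) (int n) (int k)) - fps_nth (triangular_series ^ 2) k \<and>
     (k \<ge> 3 \<longrightarrow>
        int (card (avoiders k [1, 2, 3])) = (\<Sum>n = 0..k + 1. c (int n) (int n) (int k)) \<and>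
        int (card (indec_avoiders k [1, 2, 3])) =
          (\<Sum>n = 0..k + 1. c (int n) (int n) (int k)) - fps_nth (triangular_series ^ 2) k)"
proof -
  let ?D = "{s \<in> decr_subdiagonals k. subdiag_decomposable s}"
  have fin: "finite (decr_subdiagonals k)"
    by (rule card_decr_subdiagonals(1)[OF decr_subdiagonals_length(1)])
  have card_av: "card (avoiders k [1, 2, 3]) = card (decr_subdiagonals k)"
    and card_in: "card (indec_avoiders k [1, 2, 3]) = card (indec_subdiagonals k)"
    using bij_betw_same_card bij_betw_avoiders bij_betw_indec_avoiders by blast+
  have fin_av: "finite (avoiders k [1, 2, 3])"
    using bij_betw_finite[OF bij_betw_avoiders] fin by blast
  have indec: "indec_subdiagonals k = decr_subdiagonals k - ?D"
    by (auto simp: indec_subdiagonals_def decr_subdiagonals_def)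
  have sub: "?D \<subseteq> decr_subdiagonals k" by auto
  have "int (card (decr_subdiagonals k - ?D)) = int (card (decr_subdiagonals k)) - int (card ?D)"
    using card_mono[OF fin sub] by (simp add: card_Diff_subset[OF finite_subset[OF sub fin] sub])
  then have "int (card (indec_subdiagonals k)) =
      int (card (decr_subdiagonals k)) - fps_nth (triangular_series ^ 2) k"
    unfolding indec card_decomposable_decr_subdiagonals triangular_series_square_nth .
  moreover have "finite (indec_subdiagonals k)" using fin indec by simp
  moreover have "finite (indec_avoiders k [1, 2, 3])"
    using fin_av by (auto simp: indec_avoiders_def)
  moreover have "int (card (decr_subdiagonals k)) = (\<Sum>n = 0..k + 2. c (int n) (int n) (int k))"
    by (rule card_decr_subdiagonals(2)[OF decr_subdiagonals_length(1)])
  moreover have "k \<ge> 3 \<Longrightarrow>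
      int (card (decr_subdiagonals k)) = (\<Sum>n = 0..k + 1. c (int n) (int n) (int k))"
    by (rule card_decr_subdiagonals(2)[OF decr_subdiagonals_length(2)])
  ultimately show ?thesis using fin_av card_av card_in by simp
qed

end
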